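(* Let $K$ be a locally compact field with a nontrivial non-Archimedean absolute value, with ring of integers $\mathcal{O}$ and normalized Haar measure $\mu$ on $\mathcal{O}$. For each integer $M\ge 1$ there exist a locally constant function $f:\mathcal{O}\to\mathbb{R}$ and a finite subset $X\subseteq\mathcal{O}$ such that $V_{\mathrm{Taib}}(f)=2$ and \[\left|\frac{1}{|X|}\sum_{x\in X}f(x)-\int_{\mathcal{O}}f\,d\mu\right|\ge 2M\,\Delta(X).\]
   Context: $\mathcal{O}=\{x\in K:|x|\le1\}$; $\pi$ is a uniformizer, $q$ the order of the residue field $\mathcal{O}/\pi\mathcal{O}$, and $|\pi|=1/q$. $\mu$ is the Haar measure on $\mathcal{O}$ with $\mu(\mathcal{O})=1$. A disc is $D_r(a)=\{x\in K:|x-a|\le r\}$ with $r\in q^{\mathbb{Z}}$, $r>0$. The discrepancy of a finite nonempty $X\subseteq\mathcal{O}$ is $\Delta(X)=\sup_{D\subseteq\mathcal{O}}\left|\frac{|X\cap D|}{|X|}-\mu(D)\right|$, the supremum over all discs $D\subseteq\mathcal{O}$. A Taibleson partition is a finite collection $\Pi$ of discs partitioning $\mathcal{O}$; $V_\Pi(f)=\sum_{D\in\Pi}\sup_{x,y\in D}(f(x)-f(y))$ and $V_{\mathrm{Taib}}(f)=\sup_\Pi V_\Pi(f)$. *)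

theory Defs
  imports "HOL-Analysis.Analysis" "HOL-Library.Disjoint_Sets"
begin

definition valuation_ring :: "('a::field \<Rightarrow> real) \<Rightarrow> 'a set" where
  "valuation_ring v = {x. v x \<le> 1}"

definition valuation_topology :: "('a::field \<Rightarrow> real) \<Rightarrow> 'a topology" where
  "valuation_topology v = Metric_space.mtopology UNIV (\<lambda>x y. v (x - y))"

definition residue_order :: "('a::field \<Rightarrow> real) \<Rightarrow> 'a \<Rightarrow> nat" where
  "residue_order v \<pi> =
     card (valuation_ring v //
       {(x, y). x \<in> valuation_ring v \<and> y \<in> valuation_ring v \<and>
                (\<exists>z\<in>valuation_ring v. x - y = \<pi> * z)})"

text \<open>
  Normalizing \<open>v\<close> by \<open>v \<pi> = 1 / q\<close>, with \<open>q\<close> the order of the residue field, makes the value group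
  the powers of \<open>q\<close>, which are the radii allowed for discs. Finiteness of the residue field
  follows from local compactness.
\<close>

locale nonarch_local_field =
  fixes v :: "'a::field \<Rightarrow> real" and \<pi> :: 'a
  assumes nonneg: "0 \<le> v x"
    and eq_0_iff: "v x = 0 \<longleftrightarrow> x = 0"
    and mult: "v (x * y) = v x * v y"
    and ultrametric: "v (x + y) \<le> max (v x) (v y)"
    and nontrivial: "\<exists>x. x \<noteq> 0 \<and> v x \<noteq> 1"
    and locally_compact: "locally_compact_space (valuation_topology v)"
    and uniformizer: "{x. v x < 1} = (\<lambda>z. \<pi> * z) ` valuation_ring v"
    and normalized: "v \<pi> = 1 / real (residue_order v \<pi>)"

definition normalized_haar :: "('a::field \<Rightarrow> real) \<Rightarrow> 'a measure \<Rightarrow> bool" where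
  "normalized_haar v \<mu> \<longleftrightarrow>
     space \<mu> = valuation_ring v \<and>
     sets \<mu> = sigma_sets (valuation_ring v)
                {U. openin (subtopology (valuation_topology v) (valuation_ring v)) U} \<and>
     (\<forall>A\<in>sets \<mu>. \<forall>a\<in>valuation_ring v. emeasure \<mu> ((\<lambda>x. a + x) ` A) = emeasure \<mu> A) \<and>
     emeasure \<mu> (valuation_ring v) = 1"

definition disc :: "('a::field \<Rightarrow> real) \<Rightarrow> real \<Rightarrow> 'a \<Rightarrow> 'a set" where
  "disc v r a = {x. v (x - a) \<le> r}"

definition discs :: "('a::field \<Rightarrow> real) \<Rightarrow> 'a \<Rightarrow> 'a set set" where
  "discs v \<pi> = {disc v (real (residue_order v \<pi>) powi k) a | (k::int) a. True}"

definition discrepancy :: "('a::field \<Rightarrow> real) \<Rightarrow> 'a \<Rightarrow> 'a measure \<Rightarrow> 'a set \<Rightarrow> real" where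
  "discrepancy v \<pi> \<mu> X =
     (SUP D\<in>{D \<in> discs v \<pi>. D \<subseteq> valuation_ring v}.
        \<bar>real (card (X \<inter> D)) / real (card X) - measure \<mu> D\<bar>)"

definition taibleson_partition :: "('a::field \<Rightarrow> real) \<Rightarrow> 'a \<Rightarrow> 'a set set \<Rightarrow> bool" where
  "taibleson_partition v \<pi> P \<longleftrightarrow>
     finite P \<and> P \<subseteq> discs v \<pi> \<and> partition_on (valuation_ring v) P"

text \<open>
  Variations are extended reals, since for an arbitrary function the suprema may be infinite.
\<close>

definition partition_variation :: "'a set set \<Rightarrow> ('a \<Rightarrow> real) \<Rightarrow> ereal" where
  "partition_variation P f = (\<Sum>D\<in>P. SUP (x, y)\<in>D \<times> D. ereal (f x - f y))"

definition taibleson_variation ::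
    "('a::field \<Rightarrow> real) \<Rightarrow> 'a \<Rightarrow> ('a \<Rightarrow> real) \<Rightarrow> ereal" where
  "taibleson_variation v \<pi> f =
     (SUP P\<in>{P. taibleson_partition v \<pi> P}. partition_variation P f)"

text \<open>
  A function on the valuation ring is represented by a function on the whole field, whose values
  outside the ring are irrelevant everywhere.
\<close>

definition locally_constant_on_ring :: "('a::field \<Rightarrow> real) \<Rightarrow> ('a \<Rightarrow> real) \<Rightarrow> bool" where
  "locally_constant_on_ring v f \<longleftrightarrow>
     (\<forall>x\<in>valuation_ring v.
        \<exists>U. openin (subtopology (valuation_topology v) (valuation_ring v)) U \<and>
            x \<in> U \<and> (\<forall>y\<in>U. f y = f x))"

end

theory Submission
  imports Defs
begin

text \<open>
  Let \<open>f\<close> take the values \<open>1\<close> and \<open>-1\<close> alternately on the annuli \<open>|x| = q\<^sup>-\<^sup>n\<close> for \<open>n < N\<close>, with no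
  further change of sign inside. A disc avoiding \<open>0\<close> lies in one annulus, so every partition sees
  only the oscillation \<open>2\<close> of its disc around \<open>0\<close>. Start from one representative of each residue
  class modulo \<open>\<pi>\<^sup>N\<close>, which integrates \<open>f\<close> exactly, and in the \<open>n\<close>-th annulus remove one point if
  \<open>n\<close> is even and add one if \<open>n\<close> is odd. All these modifications push the average of \<open>f\<close> in the
  same direction, by \<open>N / q\<^sup>N\<close> in total, whereas in every disc they cancel up to a single point, so
  that the discrepancy stays below \<open>2 / q\<^sup>N\<close>.
\<close>

text \<open>Neighbouring signs cancel in pairs, so an interval of indices leaves nothing or its
  first term. The bound alone does not carry an induction; the closed form inside the proof
  does.\<close>

lemma alternating_sum_bound: "\<bar>\<Sum>n=k..<N. (-1::real) ^ n\<bar> \<le> 1"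
proof (induction N)
  case (Suc N)
  have "(\<Sum>n=k..<N. (-1::real) ^ n) = (if even (k + N) \<or> N \<le> k then 0 else (-1) ^ k)" for N
    by (induction N) (auto simp: le_Suc_eq not_le)
  then show ?case by (auto simp: power_abs)
qed simp

context nonarch_local_field
begin

abbreviation "q \<equiv> residue_order v \<pi>"
abbreviation "D n a \<equiv> disc v (v \<pi> ^ n) a"

section \<open>The absolute value and its uniformizer\<close>

lemma v_one: "v 1 = 1"
  using mult[of 1 1] eq_0_iff[of 1] by simp

lemma v_zero: "v 0 = 0"
  using eq_0_iff by simp

lemma v_minus: "v (- x) = v x"
proof -
  have "v (- 1) * v (- 1) = 1" using mult[of "-1" "-1"] v_one by simp
  then have "v (- 1) = 1" using nonneg[of "-1"] square_eq_1_iff[of "v (-1)"] by auto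
  then show ?thesis using mult[of "-1" x] by simp
qed

lemma v_commute: "v (x - y) = v (y - x)"
  using v_minus[of "x - y"] by simp

lemma v_diff: "v (x - y) \<le> max (v x) (v y)"
  using ultrametric[of x "- y"] v_minus by simp

lemma v_diff_trans: "v (x - z) \<le> max (v (x - y)) (v (y - z))"
  using ultrametric[of "x - y" "y - z"] by simp

lemma v_power: "v (x ^ n) = v x ^ n"
  by (induction n) (simp_all add: v_one mult)

lemma v_inverse: "x \<noteq> 0 \<Longrightarrow> v (inverse x) = inverse (v x)"
  using mult[of x "inverse x"] v_one by (simp add: inverse_unique)

text \<open>Isosceles principle: the ultrametric inequality bounds each of \<open>v x\<close> and
  \<open>v a\<close> by the maximum of the other and \<open>v (x - a)\<close>, and the latter is too
  small to attain the maximum.\<close>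

lemma v_eq_of_close: "v (x - a) < v a \<Longrightarrow> v x = v a"
  using v_diff[of x "x - a"] ultrametric[of "x - a" a] by (auto simp: max_def split: if_splits)

lemma ring_iff: "x \<in> valuation_ring v \<longleftrightarrow> v x \<le> 1"
  by (simp add: valuation_ring_def)

lemma pi_less_1: "v \<pi> < 1"
proof -
  have "\<pi> * 1 \<in> (\<lambda>z. \<pi> * z) ` valuation_ring v"
    by (rule imageI) (simp add: ring_iff v_one)
  then show ?thesis using uniformizer by auto
qed

text \<open>Otherwise the open unit ball would be \<open>{0}\<close>, but for
  \<open>x \<noteq> 0\<close> with \<open>v x \<noteq> 1\<close> it contains \<open>x\<close> or
  \<open>inverse x\<close>.\<close>

lemma pi_nonzero: "\<pi> \<noteq> 0"
proof
  assume "\<pi> = 0"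
  then have *: "x = 0" if "v x < 1" for x
    using uniformizer that by auto
  obtain x where x: "x \<noteq> 0" "v x \<noteq> 1" using nontrivial by blast
  have "\<not> v x < 1" using * x by blast
  then have "v (inverse x) < 1"
    using x v_inverse[of x] by (simp add: inverse_less_1_iff)
  then show False using * x by force
qed

lemma pi_pos: "0 < v \<pi>"
  using pi_nonzero eq_0_iff[of \<pi>] nonneg[of \<pi>] by linarith

text \<open>With \<open>q = 0\<close> the normalization would read
  \<open>v \<pi> = 1 / 0 = 0\<close>. As infinite sets have \<open>card\<close> 0, positivity also
  yields finiteness of the residue field.\<close>

lemma q_pos: "0 < q"
  using normalized pi_pos by (cases "q = 0") auto

lemma q_pi: "real q * v \<pi> = 1"
  using normalized q_pos by simp

text \<open>Discreteness: the open unit ball is \<open>\<pi>\<close> times the ring, so no absolute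
  value lies strictly between \<open>v \<pi>\<close> and 1.\<close>

lemma less_1_iff: "v x < 1 \<longleftrightarrow> v x \<le> v \<pi>"
proof
  assume "v x < 1"
  then obtain z where "x = \<pi> * z" "v z \<le> 1"
    using uniformizer ring_iff by blast
  then show "v x \<le> v \<pi>" using pi_pos by (simp add: mult mult_left_le)
qed (use pi_less_1 in simp)

lemma pi_multiple_iff: "(\<exists>z\<in>valuation_ring v. x = \<pi> * z) \<longleftrightarrow> v x \<le> v \<pi>"
  using uniformizer less_1_iff[of x] by blast

section \<open>Residue classes modulo the uniformizer\<close>

lemma residue_representatives:
  obtains S where "finite S" "card S = q" "S \<subseteq> valuation_ring v"
    "\<And>x. x \<in> valuation_ring v \<Longrightarrow> \<exists>s\<in>S. v (x - s) \<le> v \<pi>"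
    "\<And>s t. s \<in> S \<Longrightarrow> t \<in> S \<Longrightarrow> v (s - t) \<le> v \<pi> \<Longrightarrow> s = t"
proof -
  let ?O = "valuation_ring v"
  \<comment> \<open>Congruence modulo \<open>\<pi>\<close> in metric form, so that transitivity is
    the ultrametric inequality.\<close>
  define E where "E = {(x, y). x \<in> ?O \<and> y \<in> ?O \<and> v (x - y) \<le> v \<pi>}"
  have equiv: "equiv ?O E"
    unfolding E_def
  proof (intro equivI refl_onI symI transI)
    fix x y z
    assume "(x, y) \<in> {(x, y). x \<in> ?O \<and> y \<in> ?O \<and> v (x - y) \<le> v \<pi>}"
      "(y, z) \<in> {(x, y). x \<in> ?O \<and> y \<in> ?O \<and> v (x - y) \<le> v \<pi>}"
    then show "(x, z) \<in> {(x, y). x \<in> ?O \<and> y \<in> ?O \<and> v (x - y) \<le> v \<pi>}"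
      using v_diff_trans[of x z y] by auto
  qed (use v_commute pi_pos v_zero in auto)
  have q: "q = card (?O // E)"
    unfolding residue_order_def E_def pi_multiple_iff ..
  define c where "c C = (SOME x. x \<in> C)" for C :: "'a set"
  have c: "c C \<in> C" if "C \<in> ?O // E" for C
    unfolding c_def using in_quotient_imp_non_empty[OF equiv that] by (simp add: some_in_eq)
  have cO: "c C \<in> ?O" if "C \<in> ?O // E" for C
    using c[OF that] in_quotient_imp_subset[OF equiv that] by blast
  have close: "A = B" if "A \<in> ?O // E" "B \<in> ?O // E" "v (c A - c B) \<le> v \<pi>" for A B
    using quotient_eq_iff[OF equiv that(1,2) c[OF that(1)] c[OF that(2)]] cO that
    by (simp add: E_def)
  have inj: "inj_on c (?O // E)"
  proof (rule inj_onI)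
    fix A B assume "A \<in> ?O // E" "B \<in> ?O // E" "c A = c B"
    then show "A = B" using close[of A B] pi_pos v_zero by simp
  qed
  show ?thesis
  proof
    show "finite (c ` (?O // E))"
      using q q_pos card_gt_0_iff by auto
    show "card (c ` (?O // E)) = q"
      using inj q by (simp add: card_image)
    show "c ` (?O // E) \<subseteq> ?O"
      using cO by blast
    show "\<exists>s\<in>c ` (?O // E). v (x - s) \<le> v \<pi>" if "x \<in> ?O" for x
    proof -
      have *: "E `` {x} \<in> ?O // E" using that by (rule quotientI)
      have "(x, c (E `` {x})) \<in> E" using c[OF *] by simp
      then show ?thesis using * by (auto simp: E_def)
    qed
    show "s = t" if "s \<in> c ` (?O // E)" "t \<in> c ` (?O // E)" "v (s - t) \<le> v \<pi>" for s t
      using that close by blast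
  qed
qed

section \<open>Geometry of discs\<close>

lemma disc_eqI: "b \<in> disc v r a \<Longrightarrow> disc v r b = disc v r a"
proof -
  assume "b \<in> disc v r a"
  then have ab: "v (b - a) \<le> r" "v (a - b) \<le> r"
    using v_commute[of a b] by (simp_all add: disc_def)
  \<comment> \<open>Every point of an ultrametric disc is a center, since moving the center by at
    most \<open>r\<close> does not affect distances compared with \<open>r\<close>.\<close>
  have "v (x - a) \<le> r \<longleftrightarrow> v (x - b) \<le> r" for x
    using ab v_diff_trans[of x a b] v_diff_trans[of x b a] by linarith
  then show ?thesis by (simp add: disc_def)
qed

lemma center_in_disc: "a \<in> D n a"
  using pi_pos v_zero by (simp add: disc_def)

lemma disc_subset: "m \<le> n \<Longrightarrow> D n a \<subseteq> D m a"
  using power_decreasing[of m n "v \<pi>"] pi_pos pi_less_1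
  by (auto simp: disc_def intro: order_trans)

lemma disc_0_eq_ring: "a \<in> valuation_ring v \<Longrightarrow> D 0 a = valuation_ring v"
  using disc_eqI[of a 1 0] by (auto simp: disc_def valuation_ring_def)

lemma disc_subset_ring: "a \<in> valuation_ring v \<Longrightarrow> D n a \<subseteq> valuation_ring v"
  using disc_subset[of 0 n a] disc_0_eq_ring by simp

text \<open>Excluding 0 means \<open>r < v a\<close>, so the isosceles principle puts the whole disc
  into one annulus.\<close>

lemma v_eq_on_disc: "0 \<notin> disc v r a \<Longrightarrow> x \<in> disc v r a \<Longrightarrow> v x = v a"
  using v_minus[of a] by (intro v_eq_of_close) (simp add: disc_def)

text \<open>Radii above 1 are impossible inside the ring, so nonnegative powers of
  \<open>v \<pi>\<close> suffice as radii.\<close>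

lemma discs_in_ring:
  assumes "B \<in> discs v \<pi>" "B \<subseteq> valuation_ring v"
  obtains n a where "a \<in> valuation_ring v" "B = D n a"
proof -
  obtain k a where B: "B = disc v (real q powi k) a"
    using assms by (auto simp: discs_def)
  have q: "real q = inverse (v \<pi>)"
    using q_pi pi_pos by (simp add: field_simps)
  have "0 < real q powi k" using q_pos by simp
  then have a: "a \<in> valuation_ring v"
    using assms(2) B v_zero by (force simp: disc_def)
  show ?thesis
  proof (cases "k \<le> 0")
    case True
    then have "real q powi k = v \<pi> ^ nat (- k)"
      unfolding q by (simp add: power_int_def)
    then show ?thesis using that[OF a] B by simp
  next
    case False
    \<comment> \<open>A translation by an element whose absolute value is exactly the radius stays
      in \<open>B\<close> but leaves the ring.\<close>
    let ?p = "inverse \<pi> ^ nat k"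
    have p: "v ?p = real q powi k"
      using False by (simp add: v_power v_inverse pi_nonzero q power_int_def)
    have "1 < inverse (v \<pi>)" using pi_pos pi_less_1 by (simp add: one_less_inverse_iff)
    then have "1 < v ?p"
      using False by (simp add: v_power v_inverse pi_nonzero one_less_power)
    moreover have "a + ?p \<in> B"
      using p by (simp add: B disc_def)
    ultimately show ?thesis
      using a assms(2) v_diff[of "a + ?p" a] by (force simp: ring_iff)
  qed
qed

lemma disc_in_discs: "D n a \<in> discs v \<pi>"
proof -
  have "real q = inverse (v \<pi>)"
    using q_pi pi_pos by (simp add: field_simps)
  then have "v \<pi> ^ n = real q powi (- int n)"
    by (simp add: power_int_minus power_inverse)
  then show ?thesis by (auto simp: discs_def)
qed

section \<open>Refinement of discs\<close>

text \<open>The map \<open>x \<mapsto> (x - a) / \<pi> ^ n\<close> carries \<open>D n a\<close> onto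
  the ring, where the pieces become the residue classes. Hence one set \<open>S\<close> of digits
  serves all levels and centers.\<close>

lemma disc_split:
  obtains S where "finite S" "card S = q" "S \<subseteq> valuation_ring v"
    "\<And>n a. D n a = (\<Union>s\<in>S. D (Suc n) (a + \<pi> ^ n * s))"
    "\<And>n a. disjoint_family_on (\<lambda>s. D (Suc n) (a + \<pi> ^ n * s)) S"
proof -
  obtain S where S: "finite S" "card S = q" "S \<subseteq> valuation_ring v"
    and ex: "\<And>x. x \<in> valuation_ring v \<Longrightarrow> \<exists>s\<in>S. v (x - s) \<le> v \<pi>"
    and un: "\<And>s t. s \<in> S \<Longrightarrow> t \<in> S \<Longrightarrow> v (s - t) \<le> v \<pi> \<Longrightarrow> s = t"
    using residue_representatives by metis
  \<comment> \<open>Used with \<open>k = 0\<close> and \<open>s = 0\<close> for membership in the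
    disc itself, and with \<open>k = 1\<close> for its pieces.\<close>
  have scale: "x \<in> D (n + k) (a + \<pi> ^ n * s) \<longleftrightarrow> v ((x - a) / \<pi> ^ n - s) \<le> v \<pi> ^ k" for x n k a s
  proof -
    have "x - (a + \<pi> ^ n * s) = \<pi> ^ n * ((x - a) / \<pi> ^ n - s)"
      using pi_nonzero by (simp add: field_simps)
    then show ?thesis using pi_pos by (simp add: disc_def mult v_power power_add)
  qed
  have scale1: "x \<in> D (Suc n) (a + \<pi> ^ n * s) \<longleftrightarrow> v ((x - a) / \<pi> ^ n - s) \<le> v \<pi>" for x n a s
    using scale[of x n 1 a s] by simp
  have sub: "D (Suc n) (a + \<pi> ^ n * s) \<subseteq> D n a" if "s \<in> S" for n a s
  proof -
    have "a + \<pi> ^ n * s \<in> D n a"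
      using that S(3) pi_pos by (auto simp: disc_def mult v_power ring_iff mult_left_le)
    then show ?thesis
      using disc_subset[of n "Suc n" "a + \<pi> ^ n * s"] disc_eqI by auto
  qed
  have "x \<in> (\<Union>s\<in>S. D (Suc n) (a + \<pi> ^ n * s))" if "x \<in> D n a" for x n a
    using that ex[of "(x - a) / \<pi> ^ n"] scale[of x n 0 a 0] scale1 by (simp add: ring_iff)
  then have "D n a = (\<Union>s\<in>S. D (Suc n) (a + \<pi> ^ n * s))" for n a
    using sub by blast
  moreover have "disjoint_family_on (\<lambda>s. D (Suc n) (a + \<pi> ^ n * s)) S" for n a
    unfolding disjoint_family_on_def
  proof (intro ballI impI, rule ccontr)
    fix s t assume st: "s \<in> S" "t \<in> S" "s \<noteq> t"
      and "D (Suc n) (a + \<pi> ^ n * s) \<inter> D (Suc n) (a + \<pi> ^ n * t) \<noteq> {}"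
    then obtain x where "x \<in> D (Suc n) (a + \<pi> ^ n * s)" "x \<in> D (Suc n) (a + \<pi> ^ n * t)"
      by blast
    then have "v (s - t) \<le> v \<pi>"
      unfolding scale1 using v_diff_trans[of s t "(x - a) / \<pi> ^ n"] v_commute[of s] by simp
    then show False using un st by blast
  qed
  ultimately show ?thesis using that S by blast
qed

text \<open>Each passage from level \<open>Suc n\<close> to level \<open>n\<close> joins
  \<open>q\<close> disjoint discs of equal value. The abstract \<open>m\<close> allows the same
  downward induction to serve for the Haar measure and for counting points.\<close>

lemma additive_disc:
  fixes m :: "'a set \<Rightarrow> real"
  assumes add: "\<And>(S :: 'a set) F. finite S \<Longrightarrow> disjoint_family_on F S \<Longrightarrow>
      (\<And>s. s \<in> S \<Longrightarrow> \<exists>k a. a \<in> valuation_ring v \<and> F s = D k a) \<Longrightarrow>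
      m (\<Union>s\<in>S. F s) = (\<Sum>s\<in>S. m (F s))"
    and const: "\<And>a. a \<in> valuation_ring v \<Longrightarrow> m (D N a) = c"
    and "n \<le> N" "a \<in> valuation_ring v"
  shows "m (D n a) = real q ^ (N - n) * c"
  using assms(3,4)
proof (induction arbitrary: a rule: inc_induct)
  case base
  then show ?case using const by simp
next
  case (step n)
  obtain S where S: "finite S" "card S = q" "S \<subseteq> valuation_ring v"
    and split: "\<And>n a. D n a = (\<Union>s\<in>S. D (Suc n) (a + \<pi> ^ n * s))"
    and disj: "\<And>n a. disjoint_family_on (\<lambda>s. D (Suc n) (a + \<pi> ^ n * s)) S"
    using disc_split by metis
  have *: "a + \<pi> ^ n * s \<in> valuation_ring v" if "s \<in> S" for s
    using center_in_disc[of "a + \<pi> ^ n * s" "Suc n"] split[of n a] that disc_subset_ring[OF step.prems, of n]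
    by blast
  have "m (D n a) = (\<Sum>s\<in>S. m (D (Suc n) (a + \<pi> ^ n * s)))"
    unfolding split[of n a] by (rule add[OF S(1) disj]) (use * in blast)
  also have "\<dots> = (\<Sum>s\<in>S. real q ^ (N - Suc n) * c)"
    using step.IH * by simp
  also have "\<dots> = real q ^ (N - n) * c"
    using S step.hyps by (simp flip: power_Suc mult.assoc add: Suc_diff_Suc)
  finally show ?case .
qed

text \<open>Built digit by digit: each representative \<open>r\<close> modulo
  \<open>\<pi> ^ N\<close> is replaced by the points \<open>r + \<pi> ^ N * s\<close> with
  \<open>s\<close> a residue digit.\<close>

lemma system_of_representatives:
  obtains R where "finite R" "R \<subseteq> valuation_ring v"
    "\<And>a. a \<in> valuation_ring v \<Longrightarrow> \<exists>r. R \<inter> D N a = {r}"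
proof -
  \<comment> \<open>Covering and separation are carried separately through the induction; together
    they give the unique intersection point.\<close>
  have "\<exists>R. finite R \<and> R \<subseteq> valuation_ring v \<and>
    (\<forall>a\<in>valuation_ring v. \<exists>r\<in>R. a \<in> D N r) \<and> (\<forall>r\<in>R. \<forall>t\<in>R. r \<in> D N t \<longrightarrow> r = t)"
  proof (induction N)
    case 0
    show ?case
      by (rule exI[of _ "{0}"]) (simp add: v_zero ring_iff disc_def)
  next
    case (Suc N)
    then obtain R where R: "finite R" "R \<subseteq> valuation_ring v"
      "\<forall>a\<in>valuation_ring v. \<exists>r\<in>R. a \<in> D N r" "\<forall>r\<in>R. \<forall>t\<in>R. r \<in> D N t \<longrightarrow> r = t"
      by blast
    obtain S where S: "finite S" "card S = q" "S \<subseteq> valuation_ring v"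
      and split: "\<And>n a. D n a = (\<Union>s\<in>S. D (Suc n) (a + \<pi> ^ n * s))"
      and disj: "\<And>n a. disjoint_family_on (\<lambda>s. D (Suc n) (a + \<pi> ^ n * s)) S"
      using disc_split by metis
    let ?g = "\<lambda>(r, s). r + \<pi> ^ N * s"
    have mem: "r + \<pi> ^ N * s \<in> D N r" if "s \<in> S" for r s
      using center_in_disc[of "r + \<pi> ^ N * s" "Suc N"] split[of N r] that by blast
    \<comment> \<open>Closeness at level \<open>Suc N\<close> first forces equal coarse
      representatives, then disjointness of the pieces forces equal digits.\<close>
    have "r + \<pi> ^ N * s = r' + \<pi> ^ N * s'"
      if "r \<in> R" "s \<in> S" "r' \<in> R" "s' \<in> S" "r + \<pi> ^ N * s \<in> D (Suc N) (r' + \<pi> ^ N * s')"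
      for r s r' s'
    proof -
      have "r + \<pi> ^ N * s \<in> D N r'" using split[of N r'] that by blast
      then have "D N r' = D N r"
        using disc_eqI[of "r + \<pi> ^ N * s"] mem[OF that(2), of r] by blast
      then have "r = r'" using R(4) that center_in_disc[of r N] by blast
      moreover have "s = s'"
      proof (rule ccontr)
        assume "s \<noteq> s'"
        then show False
          using disj[of N r] that \<open>r = r'\<close> center_in_disc[of "r + \<pi> ^ N * s" "Suc N"]
          unfolding disjoint_family_on_def by blast
      qed
      ultimately show ?thesis by simp
    qed
    moreover have "\<exists>x\<in>?g ` (R \<times> S). a \<in> D (Suc N) x" if "a \<in> valuation_ring v" for a
    proof -
      obtain r where "r \<in> R" "a \<in> D N r" using R(3) \<open>a \<in> valuation_ring v\<close> by blast
      then obtain s where "s \<in> S" "a \<in> D (Suc N) (r + \<pi> ^ N * s)" using split[of N r] by blast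
      then show ?thesis using \<open>r \<in> R\<close> by force
    qed
    moreover have "?g ` (R \<times> S) \<subseteq> valuation_ring v"
      using mem R(2) disc_subset_ring by fastforce
    ultimately show ?case
      using R(1) S(1) by (intro exI[of _ "?g ` (R \<times> S)"]) auto
  qed
  then obtain R where R: "finite R" "R \<subseteq> valuation_ring v"
      "\<forall>a\<in>valuation_ring v. \<exists>r\<in>R. a \<in> D N r" "\<forall>r\<in>R. \<forall>t\<in>R. r \<in> D N t \<longrightarrow> r = t"
    by blast
  have "\<exists>r. R \<inter> D N a = {r}" if "a \<in> valuation_ring v" for a
  proof -
    obtain r where r: "r \<in> R" "a \<in> D N r" using R(3) \<open>a \<in> valuation_ring v\<close> by blast
    then have "R \<inter> D N a = {r}"
      unfolding disc_eqI[OF r(2)] using center_in_disc[of r N] R(4) by blast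
    then show ?thesis by blast
  qed
  then show ?thesis using that R by blast
qed

section \<open>Haar measure of discs\<close>

lemma openin_disc: "0 < r \<Longrightarrow> openin (valuation_topology v) (disc v r a)"
proof -
  assume "0 < r"
  interpret M: Metric_space UNIV "\<lambda>x y. v (x - y)"
  proof
    show "v (x - z) \<le> v (x - y) + v (y - z)" for x y z
      using v_diff_trans[of x z y] nonneg[of "x - y"] nonneg[of "y - z"] by linarith
  qed (use nonneg eq_0_iff v_commute in auto)
  \<comment> \<open>Each point serves as center, so the open ball of the same radius around it stays
    in the disc.\<close>
  have "M.mball x r \<subseteq> disc v r a" if "x \<in> disc v r a" for x
    using disc_eqI[OF that] v_commute[of x] by (force simp: M.mball_def disc_def)
  then show ?thesis
    using \<open>0 < r\<close> unfolding valuation_topology_def M.openin_mtopology by blast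
qed

lemma openin_ring_disc:
  assumes "a \<in> valuation_ring v"
  shows "openin (subtopology (valuation_topology v) (valuation_ring v)) (D n a)"
  using openin_disc[of "v \<pi> ^ n" a] disc_subset_ring[OF assms, of n] pi_pos
  by (auto simp: openin_subtopology)

lemma haar_disc:
  assumes "normalized_haar v \<mu>" "a \<in> valuation_ring v"
  shows "D n a \<in> sets \<mu>" "measure \<mu> (D n a) = v \<pi> ^ n" "finite_measure \<mu>"
proof -
  have sets: "D k b \<in> sets \<mu>" if "b \<in> valuation_ring v" for k b
    using assms(1) openin_ring_disc[OF that, of k]
    by (auto simp: normalized_haar_def intro: sigma_sets.Basic)
  interpret finite_measure \<mu>
    using assms(1) by (intro finite_measureI) (simp add: normalized_haar_def)
  have transl: "measure \<mu> (D n b) = measure \<mu> (D n 0)" if "b \<in> valuation_ring v" for b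
  proof -
    have "D n b = (\<lambda>x. b + x) ` D n 0"
      by (auto simp: disc_def image_iff) (metis add.commute diff_add_cancel)
    then show ?thesis
      using assms(1) sets[of 0 n] that v_zero
      by (simp add: normalized_haar_def measure_def ring_iff)
  qed
  \<comment> \<open>By translation invariance all discs of level \<open>n\<close> have equal
    measure, and \<open>q ^ n\<close> of them make up the ring, of measure 1.\<close>
  have "measure \<mu> (D 0 0) = real q ^ (n - 0) * measure \<mu> (D n 0)"
  proof (rule additive_disc)
    show "measure \<mu> (\<Union>s\<in>S. F s) = (\<Sum>s\<in>S. measure \<mu> (F s))"
      if "finite S" "disjoint_family_on F S"
        "\<And>s. s \<in> S \<Longrightarrow> \<exists>k a. a \<in> valuation_ring v \<and> F s = D k a" for S :: "'a set" and F
      using that sets by (intro finite_measure_finite_Union) fastforce+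
    show "measure \<mu> (D n b) = measure \<mu> (D n 0)" if "b \<in> valuation_ring v" for b
      using that by (rule transl)
  qed (use v_zero in \<open>simp_all add: ring_iff\<close>)
  moreover have "measure \<mu> (D 0 0) = 1"
    using assms(1) disc_0_eq_ring[of 0] v_zero
    by (simp add: normalized_haar_def measure_def ring_iff)
  ultimately have "real q ^ n * measure \<mu> (D n 0) = real q ^ n * v \<pi> ^ n"
    using q_pi by (simp flip: power_mult_distrib)
  then show "measure \<mu> (D n a) = v \<pi> ^ n"
    using q_pos transl[OF assms(2)] by simp
  show "D n a \<in> sets \<mu>" by (rule sets[OF assms(2)])
  show "finite_measure \<mu>" by (rule finite_measure_axioms)
qed

section \<open>Equidistribution of the representatives\<close>

lemma card_representatives:
  assumes "finite R" and R: "\<And>a. a \<in> valuation_ring v \<Longrightarrow> \<exists>r. R \<inter> D N a = {r}"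
    and "n \<le> N" "a \<in> valuation_ring v"
  shows "real (card (R \<inter> D n a)) = real q ^ (N - n)"
proof -
  have "real (card (R \<inter> D n a)) = real q ^ (N - n) * 1"
  proof (rule additive_disc[where m = "\<lambda>B. real (card (R \<inter> B))" and N = N])
    show "real (card (R \<inter> \<Union> (F ` S))) = (\<Sum>s\<in>S. real (card (R \<inter> F s)))"
      if "finite S" "disjoint_family_on F S" for S :: "'a set" and F
    proof -
      have "card (\<Union>s\<in>S. R \<inter> F s) = (\<Sum>s\<in>S. card (R \<inter> F s))"
        using that \<open>finite R\<close>
        by (intro card_UN_disjoint) (auto simp: disjoint_family_on_def)
      then show ?thesis by (simp only: Int_UN_distrib of_nat_sum)
    qed
    show "real (card (R \<inter> D N b)) = 1" if "b \<in> valuation_ring v" for b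
      using R[OF that] by auto
  qed (use assms in auto)
  then show ?thesis by simp
qed

text \<open>Up to level \<open>N\<close> the proportion of points is exact. On smaller discs there
  is at most one point, so proportion and measure both lie between 0 and
  \<open>1 / real q ^ N\<close>.\<close>

lemma representatives_discrepancy:
  assumes "normalized_haar v \<mu>" "finite R"
    and R: "\<And>a. a \<in> valuation_ring v \<Longrightarrow> \<exists>r. R \<inter> D N a = {r}"
    and a: "a \<in> valuation_ring v"
  shows "\<bar>real (card (R \<inter> D n a)) / real q ^ N - measure \<mu> (D n a)\<bar> \<le> 1 / real q ^ N"
proof (cases "n \<le> N")
  case True
  have "real q ^ N = real q ^ (N - n) * real q ^ n"
    using True by (simp flip: power_add)
  moreover have "real q ^ n * v \<pi> ^ n = 1"
    using q_pi by (simp flip: power_mult_distrib)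
  ultimately have "real (card (R \<inter> D n a)) / real q ^ N = v \<pi> ^ n"
    using card_representatives[OF assms(2) R True a] q_pos by (simp add: field_simps)
  then show ?thesis
    using haar_disc(2)[OF assms(1) a, of n] by simp
next
  case False
  obtain r where r: "R \<inter> D N a = {r}" using R[OF a] by blast
  then have "R \<inter> D n a \<subseteq> {r}" using disc_subset[of N n a] False by auto
  then have "card (R \<inter> D n a) \<le> 1" using card_mono[of "{r}"] by fastforce
  then have "real (card (R \<inter> D n a)) / real q ^ N \<le> 1 / real q ^ N"
    by (intro divide_right_mono) auto
  moreover have "v \<pi> ^ n \<le> v \<pi> ^ N"
    using False pi_pos pi_less_1 by (intro power_decreasing) auto
  then have "measure \<mu> (D n a) \<le> 1 / real q ^ N"
    using haar_disc(2)[OF assms(1) a, of n] normalized by (simp add: power_one_over)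
  moreover have "0 \<le> real (card (R \<inter> D n a)) / real q ^ N" by simp
  moreover have "0 \<le> measure \<mu> (D n a)" by simp
  ultimately show ?thesis by linarith
qed

text \<open>Such an \<open>f\<close> is a combination of indicators of the discs of level
  \<open>N\<close> around \<open>R\<close>, each of measure \<open>1 / real q ^ N\<close>.\<close>

lemma integral_representatives:
  fixes f :: "'a \<Rightarrow> real"
  assumes "normalized_haar v \<mu>" "finite R" "R \<subseteq> valuation_ring v"
    and R: "\<And>a. a \<in> valuation_ring v \<Longrightarrow> \<exists>r. R \<inter> D N a = {r}"
    and f: "\<And>a x. a \<in> valuation_ring v \<Longrightarrow> x \<in> D N a \<Longrightarrow> f x = f a"
  shows "integral\<^sup>L \<mu> f = (\<Sum>r\<in>R. f r) / real q ^ N"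
proof -
  have sp: "space \<mu> = valuation_ring v" using assms(1) by (simp add: normalized_haar_def)
  have decomp: "f x = (\<Sum>r\<in>R. indicator (D N r) x * f r)" if x: "x \<in> space \<mu>" for x
  proof -
    obtain r where r: "R \<inter> D N x = {r}" using R x sp by blast
    have "(\<Sum>r\<in>R. indicator (D N r) x * f r) = (\<Sum>t\<in>R. if t = r then f r else 0)"
    proof (rule sum.cong)
      fix t assume "t \<in> R"
      then have "x \<in> D N t \<longleftrightarrow> t = r"
        using r v_commute[of x t] by (auto simp: disc_def)
      then show "indicator (D N t) x * f t = (if t = r then f r else 0)"
        by (simp add: indicator_def)
    qed simp
    also have "\<dots> = f r" using r \<open>finite R\<close> by auto
    also have "\<dots> = f x" using r f[of x r] x sp by blast
    finally show ?thesis by (rule sym)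
  qed
  have int: "integrable \<mu> (\<lambda>x. indicator (D N r) x * f r)" if "r \<in> R" for r
  proof -
    have "D N r \<in> sets \<mu>" "finite_measure \<mu>"
      using haar_disc[OF assms(1)] that assms(3) by blast+
    then show ?thesis
      by (intro integrable_mult_left integrable_real_indicator)
        (simp_all add: finite_measure.emeasure_finite less_top[symmetric])
  qed
  have "integral\<^sup>L \<mu> f = integral\<^sup>L \<mu> (\<lambda>x. \<Sum>r\<in>R. indicator (D N r) x * f r)"
    by (rule Bochner_Integration.integral_cong) (use decomp in auto)
  also have "\<dots> = (\<Sum>r\<in>R. integral\<^sup>L \<mu> (\<lambda>x. indicator (D N r) x * f r))"
    using int by (rule Bochner_Integration.integral_sum)
  also have "\<dots> = (\<Sum>r\<in>R. f r / real q ^ N)"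
  proof (rule sum.cong)
    fix r assume "r \<in> R"
    then have r: "r \<in> valuation_ring v" using assms(3) by blast
    have "D N r \<inter> space \<mu> = D N r" using sp disc_subset_ring[OF r, of N] by auto
    then show "integral\<^sup>L \<mu> (\<lambda>x. indicator (D N r) x * f r) = f r / real q ^ N"
      using haar_disc(2)[OF assms(1) r, of N] normalized by (simp add: power_one_over)
  qed simp
  finally show ?thesis by (simp add: sum_divide_distrib)
qed

section \<open>The alternating function and its variation\<close>

text \<open>
  On the annulus \<open>v x = v \<pi> ^ n\<close> the exponent is \<open>min n (N - 1)\<close>.
\<close>

definition annular_sign :: "nat \<Rightarrow> 'a \<Rightarrow> real" where
  "annular_sign N x = (-1) ^ card {k \<in> {1..<N}. v x \<le> v \<pi> ^ k}"

lemma annular_sign_eq: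
  assumes "v x = v \<pi> ^ n" "n < N"
  shows "annular_sign N x = (-1) ^ n"
proof -
  have "{k \<in> {1..<N}. v x \<le> v \<pi> ^ k} = {1..n}"
    using assms pi_pos pi_less_1 by (auto simp: power_decreasing_iff)
  then show ?thesis by (simp add: annular_sign_def)
qed

lemma annular_sign_const:
  assumes "0 \<notin> disc v r a" "x \<in> disc v r a"
  shows "annular_sign N x = annular_sign N a"
  using v_eq_on_disc[OF assms] by (simp add: annular_sign_def)

text \<open>If the disc contains 0, recentering there shows that its points pass all thresholds
  \<open>k < N\<close>; otherwise it lies in one annulus.\<close>

lemma annular_sign_const_disc:
  assumes "x \<in> D N a"
  shows "annular_sign N x = annular_sign N a"
proof (cases "0 \<in> D N a")
  case True
  have "annular_sign N y = (-1) ^ card {1..<N}" if "y \<in> D N a" for y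
  proof -
    have "v y \<le> v \<pi> ^ N" using that disc_eqI[OF True] by (auto simp: disc_def)
    moreover have "v \<pi> ^ N \<le> v \<pi> ^ k" if "k < N" for k
      using that pi_pos pi_less_1 by (intro power_decreasing) auto
    ultimately have "{k \<in> {1..<N}. v y \<le> v \<pi> ^ k} = {1..<N}"
      by force
    then show ?thesis by (simp add: annular_sign_def)
  qed
  then show ?thesis using assms center_in_disc[of a N] by metis
qed (use annular_sign_const assms in blast)

lemma locally_constant_annular_sign: "locally_constant_on_ring v (annular_sign N)"
  unfolding locally_constant_on_ring_def
proof (intro ballI exI conjI)
  fix x y assume "x \<in> valuation_ring v"
  then show "openin (subtopology (valuation_topology v) (valuation_ring v)) (D N x)"
    by (rule openin_ring_disc)
  show "x \<in> D N x" by (rule center_in_disc)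
  show "annular_sign N y = annular_sign N x" if "y \<in> D N x"
    using that by (rule annular_sign_const_disc)
qed

lemma annular_sign_cases: "annular_sign N x = 1 \<or> annular_sign N x = -1"
  by (simp add: annular_sign_def) (metis minus_one_power_iff)

lemma taibleson_variation_annular_sign:
  assumes "2 \<le> N"
  shows "taibleson_variation v \<pi> (annular_sign N) = 2"
proof (rule antisym)
  let ?f = "annular_sign N"
  let ?osc = "\<lambda>B. SUP (x, y)\<in>B \<times> B. ereal (?f x - ?f y)"
  show "taibleson_variation v \<pi> ?f \<le> 2"
    unfolding taibleson_variation_def
  proof (rule SUP_least)
    fix P assume "P \<in> {P. taibleson_partition v \<pi> P}"
    then have P: "finite P" "P \<subseteq> discs v \<pi>" "partition_on (valuation_ring v) P"
      by (auto simp: taibleson_partition_def)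
    \<comment> \<open>Only the block around 0 can contribute to the variation.\<close>
    have "0 \<in> \<Union>P"
      using P(3) v_zero by (auto simp: partition_on_def ring_iff)
    then obtain B0 where B0: "B0 \<in> P" "0 \<in> B0" by blast
    have zero: "?osc B = 0" if "B \<in> P" "B \<noteq> B0" for B
    proof -
      have "0 \<notin> B" using that B0 P(3) by (auto simp: partition_on_def disjoint_def)
      moreover have "B \<noteq> {}" using that P(3) by (auto simp: partition_on_def)
      moreover obtain r a where "B = disc v r a" using P(2) \<open>B \<in> P\<close> by (auto simp: discs_def)
      ultimately have const: "?f x - ?f y = 0" if "x \<in> B" "y \<in> B" for x y
        using that annular_sign_const by (metis diff_self)
      then have "?osc B = (SUP (x, y)\<in>B \<times> B. 0)"
        by (intro SUP_cong) (auto simp: const zero_ereal_def)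
      also have "\<dots> = 0" using \<open>B \<noteq> {}\<close> by (simp add: case_prod_unfold)
      finally show ?thesis .
    qed
    have "partition_variation P ?f = (\<Sum>B\<in>P. if B = B0 then ?osc B0 else 0)"
      unfolding partition_variation_def by (rule sum.cong) (use zero in auto)
    also have "\<dots> = ?osc B0" using P(1) B0 by simp
    also have "\<dots> \<le> 2"
    proof (rule SUP_least)
      fix z show "(case z of (x, y) \<Rightarrow> ereal (?f x - ?f y)) \<le> 2"
        using annular_sign_cases[of N "fst z"] annular_sign_cases[of N "snd z"]
        by (auto split: prod.split)
    qed
    finally show "partition_variation P ?f \<le> 2" .
  qed
  let ?O = "valuation_ring v"
  have O: "taibleson_partition v \<pi> {?O}"
  proof -
    have "0 \<in> ?O" using v_zero by (simp add: ring_iff)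
    then show ?thesis
      using disc_in_discs[of 0 0] disc_0_eq_ring[of 0]
      by (auto simp: taibleson_partition_def partition_on_def)
  qed
  \<comment> \<open>The trivial partition attains the bound. For the sign at \<open>\<pi>\<close>
    the annulus of index 1 must be below \<open>N\<close>, whence \<open>2 \<le> N\<close>.\<close>
  have "?f 1 = 1" "?f \<pi> = -1"
    using annular_sign_eq[of 1 0 N] annular_sign_eq[of \<pi> 1 N] assms v_one by auto
  then have "2 = ereal (?f 1 - ?f \<pi>)" by simp
  also have "\<dots> \<le> ?osc ?O"
    by (rule SUP_upper2[of "(1, \<pi>)"]) (use v_one pi_less_1 in \<open>auto simp: ring_iff\<close>)
  also have "\<dots> = partition_variation {?O} ?f"
    by (simp add: partition_variation_def)
  also have "\<dots> \<le> taibleson_variation v \<pi> ?f"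
    unfolding taibleson_variation_def using O by (intro SUP_upper) simp
  finally show "2 \<le> taibleson_variation v \<pi> ?f" .
qed

section \<open>The modified point set\<close>

text \<open>
  A disc contains either at most one of the points \<open>p n\<close> or all of them from some index on.
\<close>

lemma alternating_sum_disc_bound:
  assumes p: "\<And>n. n < N \<Longrightarrow> v (p n) = v \<pi> ^ n"
  shows "\<bar>\<Sum>n<N. (-1) ^ n * indicator (D k a) (p n) :: real\<bar> \<le> 1"
proof -
  have "(\<Sum>n<N. (-1) ^ n * indicator (D k a) (p n) :: real) =
      (\<Sum>n | n < N \<and> p n \<in> D k a. (-1) ^ n)"
    by (auto simp: indicator_def if_distrib sum.If_cases lessThan_def Int_def cong: if_cong)
  moreover have "\<bar>\<Sum>n | n < N \<and> p n \<in> D k a. (-1) ^ n :: real\<bar> \<le> 1"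
  proof (cases "0 \<in> D k a")
    case True
    have "p n \<in> D k a \<longleftrightarrow> k \<le> n" if "n < N" for n
      \<comment> \<open>Recentered at 0, the disc contains exactly the points of absolute value at
        most \<open>v \<pi> ^ k\<close>, so an interval of indices remains.\<close>
      unfolding disc_eqI[OF True, symmetric]
      using p[OF that] pi_pos pi_less_1 by (simp add: disc_def power_decreasing_iff)
    then have "{n. n < N \<and> p n \<in> D k a} = {k..<N}" by auto
    then show ?thesis using alternating_sum_bound by simp
  next
    case False
    have "m = n" if "m < N" "p m \<in> D k a" "n < N" "p n \<in> D k a" for m n
    proof -
      \<comment> \<open>The disc lies in one annulus, while distinct indices belong to distinct
        annuli.\<close>
      have "v \<pi> ^ m = v \<pi> ^ n" using v_eq_on_disc[OF False] that p by metis
      then show ?thesis using pi_pos pi_less_1 power_inject_exp'[of "v \<pi>" m n] by simp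
    qed
    then obtain m where "{n. n < N \<and> p n \<in> D k a} \<subseteq> {m}" by blast
    then have "{n. n < N \<and> p n \<in> D k a} = {} \<or> {n. n < N \<and> p n \<in> D k a} = {m}" by blast
    then show ?thesis by (elim disjE; elim ssubst; simp add: power_abs)
  qed
  ultimately show ?thesis by simp
qed

text \<open>The conclusion is stated for all test functions \<open>h\<close>, so that the constant
  1, the indicator of a disc and the alternating function give cardinality, counts and average from
  one identity.\<close>

lemma modified_representatives:
  assumes "finite R" "R \<subseteq> valuation_ring v"
    and R: "\<And>a. a \<in> valuation_ring v \<Longrightarrow> \<exists>r. R \<inter> D N a = {r}"
  obtains X p where "finite X" "X \<subseteq> valuation_ring v" "\<And>n. n < N \<Longrightarrow> v (p n) = v \<pi> ^ n"
    "\<And>h :: 'a \<Rightarrow> real. (\<Sum>x\<in>X. h x) = (\<Sum>r\<in>R. h r) - (\<Sum>n<N. (-1) ^ n * h (p n))"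
proof -
  have pow: "\<pi> ^ n \<in> valuation_ring v" for n
    using pi_pos pi_less_1 by (simp add: ring_iff v_power power_le_one)
  have "\<exists>x. x \<in> D N (\<pi> ^ n) \<and> (x \<in> R \<longleftrightarrow> even n)" for n
  proof -
    obtain r where r: "R \<inter> D N (\<pi> ^ n) = {r}" using R pow by blast
    \<comment> \<open>For odd \<open>n\<close> a new point is needed: this one shares the disc of
      \<open>r\<close> but differs from \<open>r\<close>, the only point of \<open>R\<close>
      there.\<close>
    have "r + \<pi> ^ N \<in> D N r" "r + \<pi> ^ N \<noteq> r"
      using pi_nonzero by (simp_all add: disc_def v_power)
    then have "r + \<pi> ^ N \<in> D N (\<pi> ^ n) - R"
      using r disc_eqI[of r _ "\<pi> ^ n"] by blast
    then show ?thesis using r by (cases "even n") auto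
  qed
  then obtain p where p: "\<And>n. p n \<in> D N (\<pi> ^ n)" "\<And>n. p n \<in> R \<longleftrightarrow> even n" by metis
  have vp: "v (p n) = v \<pi> ^ n" if "n < N" for n
  proof -
    \<comment> \<open>Strictness, from \<open>n < N\<close>, keeps \<open>p n\<close> in the annulus
      of \<open>\<pi> ^ n\<close>.\<close>
    have "v \<pi> ^ N < v \<pi> ^ n"
      using that pi_pos pi_less_1 by (intro power_strict_decreasing) auto
    then show ?thesis
      using p(1)[of n] v_eq_of_close[of "p n" "\<pi> ^ n"] by (simp add: disc_def v_power)
  qed
  have inj: "inj_on p {..<N}"
  proof (rule inj_onI)
    fix m n assume "m \<in> {..<N}" "n \<in> {..<N}" "p m = p n"
    then have "v \<pi> ^ m = v \<pi> ^ n" using vp by (metis lessThan_iff)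
    then show "m = n" using pi_pos pi_less_1 power_inject_exp'[of "v \<pi>" m n] by simp
  qed
  define A where "A = {n. n < N \<and> even n}"
  define B where "B = {n. n < N \<and> odd n}"
  have AB: "finite A" "finite B" "A \<inter> B = {}" "{..<N} = A \<union> B" "inj_on p A" "inj_on p B"
    by (auto simp: A_def B_def intro: inj_on_subset[OF inj])
  \<comment> \<open>Removed points do belong to \<open>R\<close> and added ones do not, so both
    changes count in full.\<close>
  have sub: "p ` A \<subseteq> R" "(R - p ` A) \<inter> p ` B = {}"
    using p(2) by (auto simp: A_def B_def)
  show ?thesis
  proof
    show "finite ((R - p ` A) \<union> p ` B)" using assms(1) AB by simp
    have "p n \<in> valuation_ring v" for n
      using p(1) disc_subset_ring pow by blast
    then show "(R - p ` A) \<union> p ` B \<subseteq> valuation_ring v"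
      using assms(2) by blast
    show "(\<Sum>x\<in>(R - p ` A) \<union> p ` B. h x) = (\<Sum>r\<in>R. h r) - (\<Sum>n<N. (-1) ^ n * h (p n))"
      for h :: "'a \<Rightarrow> real"
    proof -
      have "(\<Sum>x\<in>(R - p ` A) \<union> p ` B. h x) = (\<Sum>x\<in>R. h x) - (\<Sum>n\<in>A. h (p n)) + (\<Sum>n\<in>B. h (p n))"
        using assms(1) AB sub by (simp add: sum.union_disjoint sum_diff sum.reindex)
      moreover have "(\<Sum>n<N. (-1) ^ n * h (p n)) = (\<Sum>n\<in>A. h (p n)) + (\<Sum>n\<in>B. - h (p n))"
        unfolding AB(4) sum.union_disjoint[OF AB(1-3)]
        by (intro arg_cong2[of _ _ _ _ "(+)"] sum.cong) (auto simp: A_def B_def)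
      ultimately show ?thesis by (simp add: sum_negf)
    qed
  qed (use vp in blast)
qed

end

section \<open>Comparison of integration error and discrepancy\<close>

theorem theorem3p7:
  fixes v :: "'a::field \<Rightarrow> real" and \<pi> :: 'a and \<mu> :: "'a measure" and M :: nat
  assumes "nonarch_local_field v \<pi>"
    and "normalized_haar v \<mu>"
    and "M \<ge> 1"
  shows "\<exists>(f :: 'a \<Rightarrow> real) (X :: 'a set).
           locally_constant_on_ring v f \<and>
           finite X \<and> X \<noteq> {} \<and> X \<subseteq> valuation_ring v \<and>
           taibleson_variation v \<pi> f = 2 \<and>
           \<bar>(\<Sum>x\<in>X. f x) / real (card X) - integral\<^sup>L \<mu> f\<bar>
             \<ge> 2 * real M * discrepancy v \<pi> \<mu> X"
proof -
  interpret nonarch_local_field v \<pi> by fact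
  \<comment> \<open>An even \<open>N\<close> makes removals and additions balance, keeping the
    cardinality \<open>q ^ N\<close>; the factor 4 gives
    \<open>N / q ^ N = 2 * M * (2 / q ^ N)\<close>.\<close>
  define N where "N = 4 * M"
  let ?f = "annular_sign N"
  have zero: "0 \<in> valuation_ring v" using v_zero by (simp add: ring_iff)
  obtain R where R: "finite R" "R \<subseteq> valuation_ring v"
    "\<And>a. a \<in> valuation_ring v \<Longrightarrow> \<exists>r. R \<inter> D N a = {r}"
    using system_of_representatives[of N] by metis
  obtain X p where X: "finite X" "X \<subseteq> valuation_ring v" "\<And>n. n < N \<Longrightarrow> v (p n) = v \<pi> ^ n"
    and sumX: "\<And>h :: 'a \<Rightarrow> real. (\<Sum>x\<in>X. h x) = (\<Sum>r\<in>R. h r) - (\<Sum>n<N. (-1) ^ n * h (p n))"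
    using modified_representatives[OF R] by metis
  have "real (card R) = real q ^ N"
    using card_representatives[OF R(1,3), where n = 0 and a = 0] zero disc_0_eq_ring[OF zero] R(2)
    by (simp add: Int_absorb2)
  moreover have "(\<Sum>n<N. (-1) ^ n :: real) = 0"
    unfolding N_def by (simp add: sum_gp_strict)
  ultimately have cardX: "real (card X) = real q ^ N"
    using sumX[of "\<lambda>_. 1"] by simp
  have qN: "0 < real q ^ N" using q_pos by simp
  \<comment> \<open>The sign of each modification matches the sign of the function there, so all
    \<open>N\<close> effects add up.\<close>
  have "(\<Sum>n<N. (-1) ^ n * ?f (p n)) = (\<Sum>n<N. 1)"
    using annular_sign_eq X(3) by (intro sum.cong) (auto simp flip: power_mult_distrib)
  then have error: "(\<Sum>x\<in>X. ?f x) / real (card X) - integral\<^sup>L \<mu> ?f = - (real N / real q ^ N)"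
    using sumX[of ?f] integral_representatives[OF assms(2) R, of ?f] annular_sign_const_disc cardX
    by (simp add: diff_divide_distrib)
  have "discrepancy v \<pi> \<mu> X \<le> 2 / real q ^ N"
    unfolding discrepancy_def
  proof (rule cSUP_least)
    show "{B \<in> discs v \<pi>. B \<subseteq> valuation_ring v} \<noteq> {}"
      using disc_in_discs[of 0 0] disc_subset_ring[OF zero, of 0] by blast
    fix B assume "B \<in> {B \<in> discs v \<pi>. B \<subseteq> valuation_ring v}"
    then obtain n a where a: "a \<in> valuation_ring v" and B: "B = D n a"
      using discs_in_ring by blast
    let ?s = "\<Sum>n<N. (-1) ^ n * indicator B (p n) :: real"
    have count: "real (card (Y \<inter> B)) = sum (indicator B) Y" if "finite Y" for Y
      using that by (simp add: indicator_def of_bool_def sum.If_cases)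
    have "real (card (X \<inter> B)) = real (card (R \<inter> B)) - ?s"
      using sumX[of "indicator B"] count[OF X(1)] count[OF R(1)] by simp
    \<comment> \<open>The deviation splits into that of \<open>R\<close> and the alternating count
      of modified points in \<open>B\<close>, each at most \<open>1 / real q ^ N\<close>.\<close>
    then have "real (card (X \<inter> B)) / real (card X) - measure \<mu> B
        = (real (card (R \<inter> B)) / real q ^ N - measure \<mu> B) - ?s / real q ^ N"
      unfolding cardX by (simp add: diff_divide_distrib)
    moreover have "\<bar>real (card (R \<inter> B)) / real q ^ N - measure \<mu> B\<bar> \<le> 1 / real q ^ N"
      unfolding B by (rule representatives_discrepancy[OF assms(2) R(1,3) a])
    moreover have "\<bar>?s\<bar> \<le> 1"
      unfolding B by (rule alternating_sum_disc_bound[OF X(3)])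
    then have "\<bar>?s / real q ^ N\<bar> \<le> 1 / real q ^ N"
      using qN by (simp add: divide_right_mono)
    ultimately show "\<bar>real (card (X \<inter> B)) / real (card X) - measure \<mu> B\<bar> \<le> 2 / real q ^ N"
      by linarith
  qed
  then have "2 * real M * discrepancy v \<pi> \<mu> X \<le> 2 * real M * (2 / real q ^ N)"
    by (rule mult_left_mono) simp
  also have "\<dots> = real N / real q ^ N" by (simp add: N_def)
  also have "\<dots> = \<bar>(\<Sum>x\<in>X. ?f x) / real (card X) - integral\<^sup>L \<mu> ?f\<bar>"
    unfolding error by simp
  finally have "2 * real M * discrepancy v \<pi> \<mu> X
      \<le> \<bar>(\<Sum>x\<in>X. ?f x) / real (card X) - integral\<^sup>L \<mu> ?f\<bar>" .
  moreover have "X \<noteq> {}" using cardX qN by auto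
  moreover have "2 \<le> N" using assms(3) by (simp add: N_def)
  ultimately show ?thesis
    using locally_constant_annular_sign taibleson_variation_annular_sign X(1,2)
    by blast
qed

end
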